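(* Consider the following procedure on input $y^*\in\mathbb R^p$: compute an optimal extreme point solution $(\widehat w,\widehat\alpha)\in\mathbb R^p\times\mathbb R$ of the problem $(\text{Sep-}y^* )$ $$\min\ (y^* )^{\mathsf T}w-\alpha\quad\text{s.t.}\quad y^{\mathsf T}w-\alpha\ge 0\ \ \forall y\in\mathcal Q,\qquad \sum_{i=1}^p w_i=1,\qquad w_i\ge 0\ (i=1,\dots,p);$$ if $(y^* )^{\mathsf T}\widehat w-\widehat\alpha<0$, return $(\textit{outside},H)$ with $H=\{y\in\mathbb R^p:\widehat w^{\mathsf T}y=\widehat\alpha\}$; otherwise return $(\textit{inside},\emptyset)$. This procedure is a point separating oracle for $\mathcal Q^+$, and every hyperplane $H$ it returns is facet supporting for $\mathcal Q^+$.
   Context: Setting: $p\in\mathbb N$, $\mathcal X$ is a set, $f\colon\mathcal X\to\mathbb R^p$, and one considers the multi-objective problem $\min f(x)$ s.t. $x\in\mathcal X$. Put $\mathcal Q:=f(\mathcal X)$ and let $\mathcal Q^+:=\mathrm{cl}\,\mathrm{conv}\,f(\mathcal X)+\mathbb R^p_{\ge 0}$ be the Edgeworth-Pareto hull, where $\mathbb R^p_{\ge 0}=\{y\in\mathbb R^p: y\ge 0\}$ (inequalities componentwise). Standing assumptions: (1) for every $w\in\mathbb Q^p_{\ge 0}$ the value $\inf\{w^{\mathsf T}f(x):x\in\mathcal X\}$ is computable and finite; (2) $\mathcal Q^+$ is finitely generated. Under these assumptions the paper takes $\mathcal Q^+$ to be a closed convex rational polyhedron with recession cone $\mathbb R^p_{\ge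 0}$, and there is $y\in\mathbb R^p$ with $\mathcal Q^+\subseteq y+\mathbb R^p_{\ge 0}$. A point separating oracle for $\mathcal Q^+$ takes a point $y^*\in\mathbb R^p$ and returns: $(\textit{inside},\emptyset)$ if $y^*\in\mathcal Q^+$; and otherwise $(\textit{outside},H)$, where $H=\{y\in\mathbb R^p:w^{\mathsf T}y=\alpha\}$ is a supporting hyperplane of $\mathcal Q^+$ with $w^{\mathsf T}y^*<\alpha$ and $w^{\mathsf T}\widehat y\ge\alpha$ for all $\widehat y\in\mathcal Q^+$. A hyperplane $H=\{y: a^{\mathsf T}y=\beta\}$ supports a polyhedron $P$ in $F:=P\cap H$ if $F\neq\emptyset$ and $a^{\mathsf T}y\ge\beta$ for all $y\in P$. It is facet supporting for $P$ if moreover $F$ is a facet, i.e. has affine dimension $\dim P-1$. In the paper, $(\text{Sep-}y^* )$ is solved by a cutting-plane approach: a candidate $(\widehat w,\widehat\alpha)$ violates some constraint $y^{\mathsf T}w-\alpha\ge0$, $y\in\mathcal Q$, iff $\inf\{\widehat w^{\mathsf T}f(x):x\in\mathcal X\}<\widehat\alpha$, so constraints are separated by solving weighted-sum problems. *)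

theory Defs
  imports "HOL-Analysis.Analysis"
begin

definition nonneg_orthant :: "(real ^ 'p) set"
  where "nonneg_orthant = {y. \<forall>i. 0 \<le> y $ i}"

definition edgeworth_pareto_hull :: "'a set \<Rightarrow> ('a \<Rightarrow> real ^ 'p) \<Rightarrow> (real ^ 'p) set"
  where "edgeworth_pareto_hull X f =
    {q + c | q c. q \<in> closure (convex hull (f ` X)) \<and> c \<in> nonneg_orthant}"

(* The infimum is taken in the extended reals, so that finiteness excludes both
   an unbounded problem and an empty feasible set X. *)
definition weighted_sum_finite :: "'a set \<Rightarrow> ('a \<Rightarrow> real ^ 'p) \<Rightarrow> real ^ 'p \<Rightarrow> bool"
  where "weighted_sum_finite X f w \<longleftrightarrow> \<bar>INF x\<in>X. ereal (w \<bullet> f x)\<bar> \<noteq> \<infinity>"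

(* V is the set of generating points, R the set of generating directions;
   convex_cone hull {} = {0}. *)
definition finitely_generated :: "(real ^ 'p) set \<Rightarrow> bool"
  where "finitely_generated P \<longleftrightarrow>
    (\<exists>V R. finite V \<and> finite R \<and>
      P = {v + r | v r. v \<in> convex hull V \<and> r \<in> convex_cone hull R})"

definition hyperplane :: "real ^ 'p \<Rightarrow> real \<Rightarrow> (real ^ 'p) set"
  where "hyperplane a b = {y. a \<bullet> y = b}"

definition supports :: "real ^ 'p \<Rightarrow> real \<Rightarrow> (real ^ 'p) set \<Rightarrow> bool"
  where "supports a b P \<longleftrightarrow>
    a \<noteq> 0 \<and> P \<inter> hyperplane a b \<noteq> {} \<and> (\<forall>y\<in>P. a \<bullet> y \<ge> b)"

definition facet_supporting :: "(real ^ 'p) set \<Rightarrow> (real ^ 'p) set \<Rightarrow> bool"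
  where "facet_supporting H P \<longleftrightarrow>
    (\<exists>a b. H = hyperplane a b \<and> supports a b P) \<and> (P \<inter> H) facet_of P"

datatype verdict = Inside | Outside

definition point_separating_oracle ::
    "(real ^ 'p) set \<Rightarrow> (real ^ 'p \<Rightarrow> verdict \<times> (real ^ 'p) set) \<Rightarrow> bool"
  where "point_separating_oracle P oracle \<longleftrightarrow>
    (\<forall>ystar.
      (ystar \<in> P \<longrightarrow> oracle ystar = (Inside, {})) \<and>
      (ystar \<notin> P \<longrightarrow>
        (\<exists>w \<alpha>. oracle ystar = (Outside, hyperplane w \<alpha>) \<and>
          supports w \<alpha> P \<and> w \<bullet> ystar < \<alpha> \<and> (\<forall>y\<in>P. w \<bullet> y \<ge> \<alpha>))))"

definition sep_feasible :: "'a set \<Rightarrow> ('a \<Rightarrow> real ^ 'p) \<Rightarrow> ((real ^ 'p) \<times> real) set"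
  where "sep_feasible X f =
    {(w, \<alpha>). (\<forall>y \<in> f ` X. y \<bullet> w - \<alpha> \<ge> 0) \<and> (\<Sum>i\<in>UNIV. w $ i) = 1 \<and> (\<forall>i. w $ i \<ge> 0)}"

definition sep_objective :: "real ^ 'p \<Rightarrow> (real ^ 'p) \<times> real \<Rightarrow> real"
  where "sep_objective ystar = (\<lambda>(w, \<alpha>). ystar \<bullet> w - \<alpha>)"

definition optimal_extreme_point_solution ::
    "'a set \<Rightarrow> ('a \<Rightarrow> real ^ 'p) \<Rightarrow> real ^ 'p \<Rightarrow> (real ^ 'p) \<times> real \<Rightarrow> bool"
  where "optimal_extreme_point_solution X f ystar s \<longleftrightarrow>
    s extreme_point_of sep_feasible X f \<and>
    (\<forall>t \<in> sep_feasible X f. sep_objective ystar s \<le> sep_objective ystar t)"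

(* An optimal extreme point need not be unique, so the procedure is parametrised by
   the map sol that selects the solution of the separation problem for each input. *)
definition sep_procedure ::
    "(real ^ 'p \<Rightarrow> (real ^ 'p) \<times> real) \<Rightarrow> real ^ 'p \<Rightarrow> verdict \<times> (real ^ 'p) set"
  where "sep_procedure sol ystar =
    (let (w, \<alpha>) = sol ystar
     in if ystar \<bullet> w - \<alpha> < 0 then (Outside, hyperplane w \<alpha>) else (Inside, {}))"

end

(* Under the assumptions the hull Q+ equals conv V + R^p_{>=0} for a finite set V, so the
   feasible set of the separation problem is cut out by finitely many constraints
   alpha <= w . v and w_i >= 0 over the unit simplex.  If y* lies outside Q+, a separating
   hyperplane has a nonnegative normal and rescales to a feasible point of negative objective
   value; optimality then makes some constraint alpha <= w . v tight.  If the supported face F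
   had dimension below p - 1, there would be a nonzero d with coordinate sum 0 for which d . y
   is a constant delta on F.  Since F recedes along the i-th axis whenever w_i = 0, such a d keeps all
   tight constraints tight, so (w, alpha) would be the midpoint of two feasible points
   (w, alpha) +- eps (d, delta). *)

theory Submission
  imports Defs
begin

section \<open>The nonnegative orthant and the Edgeworth-Pareto hull\<close>

lemma nonneg_orthant_iff: "c \<in> nonneg_orthant \<longleftrightarrow> (\<forall>i. 0 \<le> c $ i)"
  by (simp add: nonneg_orthant_def)

lemma inner_nonneg_orthant:
  assumes "w \<in> nonneg_orthant" "c \<in> nonneg_orthant"
  shows "0 \<le> w \<bullet> c"
  using assms by (auto simp: nonneg_orthant_iff inner_vec_def intro!: sum_nonneg)

lemma closed_nonneg_orthant: "closed (nonneg_orthant :: (real ^ 'p) set)"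
  unfolding nonneg_orthant_def
  by (intro closed_Collect_all closed_Collect_le continuous_intros)

lemma convex_cone_nonneg_orthant: "convex_cone (nonneg_orthant :: (real ^ 'p) set)"
proof -
  have "0 \<in> (nonneg_orthant :: (real ^ 'p) set)" by (simp add: nonneg_orthant_iff)
  then have "(nonneg_orthant :: (real ^ 'p) set) \<noteq> {}" by blast
  then show ?thesis by (simp add: convex_cone_def convex_def conic_def nonneg_orthant_iff)
qed

lemma axis_nonneg_orthant: "axis i 1 \<in> nonneg_orthant"
  by (simp add: nonneg_orthant_iff axis_def)

lemma nonneg_orthant_if_bounded_below:
  fixes w y :: "real ^ 'p"
  assumes "\<And>c. c \<in> nonneg_orthant \<Longrightarrow> b \<le> w \<bullet> (y + c)"
  shows "w \<in> nonneg_orthant"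
proof (rule ccontr)
  assume "w \<notin> nonneg_orthant"
  then obtain i where i: "w $ i < 0" by (auto simp: nonneg_orthant_iff not_le)
  \<comment> \<open>With this \<open>t\<close> the \<open>i\<close>-th axis contributes
    \<open>- (\<bar>b - w \<bullet> y\<bar> + 1)\<close>, which takes the value to at most
    \<open>b - 1\<close>.\<close>
  define t where "t = (\<bar>b - w \<bullet> y\<bar> + 1) / (- w $ i)"
  have "axis i t \<in> nonneg_orthant"
    using i by (simp add: t_def nonneg_orthant_iff axis_def divide_nonneg_neg)
  from assms[OF this] have "b \<le> w \<bullet> y + w $ i * t"
    by (simp add: inner_add_right inner_axis)
  moreover have "w $ i * t = - (\<bar>b - w \<bullet> y\<bar> + 1)"
    using i by (simp add: t_def)
  ultimately show False by linarith
qed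

text \<open>A closed halfspace is closed and convex, so it passes from the image of \<open>f\<close>
  to the closure of its convex hull; adding orthant vectors cannot decrease the product with a
  nonnegative \<open>w\<close>.\<close>

lemma edgeworth_pareto_hull_ge_iff:
  assumes "w \<in> nonneg_orthant"
  shows "(\<forall>y\<in>edgeworth_pareto_hull X f. \<alpha> \<le> w \<bullet> y) \<longleftrightarrow> (\<forall>x\<in>X. \<alpha> \<le> w \<bullet> f x)"
proof
  assume *: "\<forall>y\<in>edgeworth_pareto_hull X f. \<alpha> \<le> w \<bullet> y"
  show "\<forall>x\<in>X. \<alpha> \<le> w \<bullet> f x"
  proof
    fix x assume "x \<in> X"
    then have "f x \<in> closure (convex hull (f ` X))"
      by (meson closure_subset hull_subset image_eqI subsetD)
    then have "f x + 0 \<in> edgeworth_pareto_hull X f"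
      unfolding edgeworth_pareto_hull_def by (force simp: nonneg_orthant_iff)
    with * show "\<alpha> \<le> w \<bullet> f x" by auto
  qed
next
  assume *: "\<forall>x\<in>X. \<alpha> \<le> w \<bullet> f x"
  have "closure (convex hull (f ` X)) \<subseteq> {y. w \<bullet> y \<ge> \<alpha>}"
    using * by (intro closure_minimal hull_minimal closed_halfspace_ge convex_halfspace_ge) auto
  then show "\<forall>y\<in>edgeworth_pareto_hull X f. \<alpha> \<le> w \<bullet> y"
    using inner_nonneg_orthant[OF assms]
    by (fastforce simp: edgeworth_pareto_hull_def inner_add_right)
qed

lemma edgeworth_pareto_hull_add_orthant:
  assumes "y \<in> edgeworth_pareto_hull X f" "c \<in> nonneg_orthant"
  shows "y + c \<in> edgeworth_pareto_hull X f"
proof -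
  obtain q d where "y = q + d" "q \<in> closure (convex hull (f ` X))" "d \<in> nonneg_orthant"
    using assms(1) by (auto simp: edgeworth_pareto_hull_def)
  moreover have "d + c \<in> nonneg_orthant"
    using \<open>d \<in> nonneg_orthant\<close> assms(2) by (simp add: nonneg_orthant_iff)
  ultimately show ?thesis
    unfolding edgeworth_pareto_hull_def by (force simp: add.assoc)
qed

lemma weighted_sum_finite_imp_bounded_below:
  assumes "weighted_sum_finite X f w"
  obtains m where "\<And>x. x \<in> X \<Longrightarrow> m \<le> w \<bullet> f x"
proof -
  obtain m where m: "(INF x\<in>X. ereal (w \<bullet> f x)) = ereal m"
    using assms unfolding weighted_sum_finite_def by auto
  show thesis
  proof
    fix x assume "x \<in> X"
    then have "(INF x\<in>X. ereal (w \<bullet> f x)) \<le> ereal (w \<bullet> f x)" by (rule INF_lower)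
    then show "m \<le> w \<bullet> f x" using m by simp
  qed
qed

lemma weighted_sum_finite_imp_nonempty: "weighted_sum_finite X f w \<Longrightarrow> X \<noteq> {}"
  by (auto simp: weighted_sum_finite_def top_ereal_def)

text \<open>Finiteness for the unit weights bounds every coordinate from below on the hull, so no
  generating direction has a negative entry. Since the hull also absorbs the orthant, the cone of
  generating directions may be replaced by the whole orthant.\<close>

lemma edgeworth_pareto_hull_eq_polytope_plus_orthant:
  fixes f :: "'a \<Rightarrow> real ^ 'p"
  assumes fin: "\<And>i. weighted_sum_finite X f (axis i 1)"
    and gen: "finitely_generated (edgeworth_pareto_hull X f)"
  obtains V where "finite V" "V \<noteq> {}"
    "edgeworth_pareto_hull X f = {v + c | v c. v \<in> convex hull V \<and> c \<in> nonneg_orthant}"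
proof -
  let ?P = "edgeworth_pareto_hull X f"
  obtain V R where V: "finite V"
    and P: "?P = {v + r | v r. v \<in> convex hull V \<and> r \<in> convex_cone hull R}"
    using gen by (auto simp: finitely_generated_def)
  obtain x where "x \<in> X"
    using weighted_sum_finite_imp_nonempty[OF fin] by blast
  then have "f x \<in> closure (convex hull (f ` X))"
    by (meson closure_subset hull_subset image_eqI subsetD)
  then have "f x + 0 \<in> ?P"
    unfolding edgeworth_pareto_hull_def by (force simp: nonneg_orthant_iff)
  then have "V \<noteq> {}" using P by auto
  then obtain v where v: "v \<in> convex hull V" by (meson hull_inc ex_in_conv)
  have "R \<subseteq> nonneg_orthant"
  proof
    fix r assume r: "r \<in> R"
    show "r \<in> nonneg_orthant" unfolding nonneg_orthant_iff
    proof
      fix i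
      obtain m where "\<And>x. x \<in> X \<Longrightarrow> m \<le> axis i 1 \<bullet> f x"
        using weighted_sum_finite_imp_bounded_below[OF fin] by blast
      then have m: "\<forall>y\<in>?P. m \<le> axis i 1 \<bullet> y"
        by (simp add: edgeworth_pareto_hull_ge_iff axis_nonneg_orthant)
      show "0 \<le> r $ i"
      proof (rule ccontr)
        assume neg: "\<not> 0 \<le> r $ i"
        \<comment> \<open>Going this far along \<open>r\<close> from \<open>v\<close> takes the
          \<open>i\<close>-th coordinate below its lower bound \<open>m\<close>.\<close>
        define t where "t = (\<bar>m - v $ i\<bar> + 1) / (- r $ i)"
        have "t \<ge> 0" using neg by (simp add: t_def divide_nonneg_neg)
        then have "t *\<^sub>R r \<in> convex_cone hull R"
          using r by (simp add: convex_cone_hull_mul hull_inc)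
        then have "v + t *\<^sub>R r \<in> ?P" using v P by blast
        with m have "m \<le> v $ i + t * r $ i"
          by (force simp: inner_commute[of "axis i 1"] inner_axis)
        moreover have "t * r $ i = - (\<bar>m - v $ i\<bar> + 1)"
          using neg by (simp add: t_def)
        ultimately show False by linarith
      qed
    qed
  qed
  then have cone: "convex_cone hull R \<subseteq> nonneg_orthant"
    by (rule hull_minimal) (rule convex_cone_nonneg_orthant)
  have "?P = {v + c | v c. v \<in> convex hull V \<and> c \<in> nonneg_orthant}"
  proof
    show "?P \<subseteq> {v + c | v c. v \<in> convex hull V \<and> c \<in> nonneg_orthant}"
      using P cone by blast
    have "v + c \<in> ?P" if "v \<in> convex hull V" "c \<in> nonneg_orthant" for v c
    proof -
      \<comment> \<open>The cone contains 0, so \<open>v\<close> itself lies in the hull; absorption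
        of the orthant then adds \<open>c\<close>, without asking whether \<open>c\<close> lies in
        \<open>convex_cone hull R\<close>.\<close>
      have "v + 0 \<in> ?P" using that(1) P convex_cone_hull_contains_0 by blast
      then show ?thesis using edgeworth_pareto_hull_add_orthant that(2) by fastforce
    qed
    then show "{v + c | v c. v \<in> convex hull V \<and> c \<in> nonneg_orthant} \<subseteq> ?P" by blast
  qed
  with V \<open>V \<noteq> {}\<close> show thesis by (rule that)
qed

section \<open>Reduction of the constraints to finitely many generators\<close>

lemma sep_feasible_iff:
  "(w, \<alpha>) \<in> sep_feasible X f \<longleftrightarrow>
    w \<in> nonneg_orthant \<and> (\<Sum>i\<in>UNIV. w $ i) = 1 \<and> (\<forall>y\<in>edgeworth_pareto_hull X f. \<alpha> \<le> w \<bullet> y)"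
proof (cases "w \<in> nonneg_orthant")
  case True
  show ?thesis
    unfolding edgeworth_pareto_hull_ge_iff[OF True]
    using True by (auto simp: sep_feasible_def nonneg_orthant_iff inner_commute)
next
  case False
  then show ?thesis by (auto simp: sep_feasible_def nonneg_orthant_iff)
qed

lemma polytope_plus_orthant_superset:
  assumes P: "P = {v + c | v c. v \<in> convex hull V \<and> c \<in> nonneg_orthant}"
  shows "V \<subseteq> P"
proof
  fix v assume "v \<in> V"
  then have "v + 0 \<in> P"
    unfolding P using hull_inc[of v V convex] by (force simp: nonneg_orthant_iff simp del: add_0_right)
  then show "v \<in> P" by simp
qed

lemma convex_polytope_plus_orthant:
  "convex {v + c | v c. v \<in> convex hull V \<and> c \<in> (nonneg_orthant :: (real ^ 'p) set)}"
proof -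
  \<comment> \<open>\<open>convex_sums\<close> states the Minkowski sum as a union of
    singletons.\<close>
  have "convex (\<Union>x\<in>convex hull V. \<Union>y\<in>(nonneg_orthant :: (real ^ 'p) set). {x + y})"
    by (intro convex_sums convex_convex_hull)
      (use convex_cone_nonneg_orthant[where 'p = 'p] in \<open>simp add: convex_cone_def\<close>)
  also have "\<dots> = {v + c | v c. v \<in> convex hull V \<and> c \<in> nonneg_orthant}" by blast
  finally show ?thesis by simp
qed

text \<open>The convex hull of a finite set is compact, and a compact set plus a closed set is
  closed.\<close>

lemma closed_polytope_plus_orthant:
  assumes "finite V"
  shows "closed {v + c | v c. v \<in> convex hull V \<and> c \<in> (nonneg_orthant :: (real ^ 'p) set)}"
proof -
  have "closed (\<Union>x\<in>convex hull V. \<Union>y\<in>(nonneg_orthant :: (real ^ 'p) set). {x + y})"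
    using assms by (intro compact_closed_sums closed_nonneg_orthant finite_imp_compact_convex_hull)
  also have "\<dots> = {v + c | v c. v \<in> convex hull V \<and> c \<in> nonneg_orthant}" by blast
  finally show ?thesis by simp
qed

text \<open>One constraint per generator suffices: a halfspace containing \<open>V\<close> contains
  its convex hull, and orthant vectors only increase the product with \<open>w\<close>.\<close>

lemma polytope_plus_orthant_ge_iff:
  assumes P: "P = {v + c | v c. v \<in> convex hull V \<and> c \<in> nonneg_orthant}"
    and w: "w \<in> nonneg_orthant"
  shows "(\<forall>y\<in>P. \<alpha> \<le> w \<bullet> y) \<longleftrightarrow> (\<forall>v\<in>V. \<alpha> \<le> w \<bullet> v)"
proof
  assume "\<forall>y\<in>P. \<alpha> \<le> w \<bullet> y"
  then show "\<forall>v\<in>V. \<alpha> \<le> w \<bullet> v"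
    using polytope_plus_orthant_superset[OF P] by blast
next
  assume *: "\<forall>v\<in>V. \<alpha> \<le> w \<bullet> v"
  have "convex hull V \<subseteq> {y. w \<bullet> y \<ge> \<alpha>}"
    using * by (intro hull_minimal convex_halfspace_ge) auto
  then show "\<forall>y\<in>P. \<alpha> \<le> w \<bullet> y"
    using inner_nonneg_orthant[OF w] by (fastforce simp: P inner_add_right)
qed

section \<open>Existence of optimal extreme points\<close>

lemma convex_sep_feasible:
  fixes f :: "'a \<Rightarrow> real ^ 'p"
  shows "convex (sep_feasible X f)"
proof (rule convexI)
  fix s t :: "(real ^ 'p) \<times> real" and u v :: real
  assume st: "s \<in> sep_feasible X f" "t \<in> sep_feasible X f" and uv: "0 \<le> u" "0 \<le> v" "u + v = 1"
  obtain a \<alpha> b \<beta> where [simp]: "s = (a, \<alpha>)" "t = (b, \<beta>)" by (cases s, cases t)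
  have "u * \<alpha> + v * \<beta> \<le> (u *\<^sub>R a + v *\<^sub>R b) \<bullet> y" if "y \<in> edgeworth_pareto_hull X f" for y
    using st uv that
    by (auto simp: sep_feasible_iff inner_add_left intro!: add_mono mult_left_mono)
  moreover have "u *\<^sub>R a + v *\<^sub>R b \<in> nonneg_orthant"
    using st uv by (simp add: sep_feasible_iff nonneg_orthant_iff)
  moreover have "(\<Sum>i\<in>UNIV. (u *\<^sub>R a + v *\<^sub>R b) $ i) = 1"
    using st uv by (simp add: sep_feasible_iff sum.distrib flip: sum_distrib_left)
  ultimately show "u *\<^sub>R s + v *\<^sub>R t \<in> sep_feasible X f"
    by (simp add: sep_feasible_iff)
qed

lemma closed_sep_feasible: "closed (sep_feasible X f)"
proof -
  have eq: "sep_feasible X f =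
      (\<Inter>y\<in>f ` X. {t. snd t \<le> y \<bullet> fst t}) \<inter>
      ({t. (\<Sum>i\<in>UNIV. fst t $ i) = 1} \<inter> (\<Inter>i. {t. 0 \<le> fst t $ i}))"
    by (auto simp: sep_feasible_def)
  show ?thesis unfolding eq
    by (intro closed_Int closed_INT ballI closed_Collect_le closed_Collect_eq continuous_intros)
qed

text \<open>In this form the objective is visibly continuous, and its minimizers are cut out of the
  feasible set by a supporting hyperplane.\<close>

lemma sep_objective_eq_inner: "sep_objective ystar t = (ystar, - 1) \<bullet> t"
  by (cases t) (simp add: sep_objective_def)

text \<open>Weights in the unit simplex have norm at most 1. The constraint at a single point of
  \<open>X\<close> bounds \<open>\<alpha>\<close> from above, and the bound \<open>c\<close> on the
  objective bounds it from below.\<close>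

lemma bounded_sep_sublevel:
  assumes "X \<noteq> {}"
  shows "bounded {t \<in> sep_feasible X f. sep_objective ystar t \<le> c}"
proof -
  obtain x where x: "x \<in> X" using assms by blast
  have "{t \<in> sep_feasible X f. sep_objective ystar t \<le> c} \<subseteq>
      cball 0 1 \<times> {- norm ystar - c .. norm (f x)}"
  proof
    fix t assume t: "t \<in> {t \<in> sep_feasible X f. sep_objective ystar t \<le> c}"
    obtain w \<alpha> where t_eq: "t = (w, \<alpha>)" by (cases t)
    have S: "(w, \<alpha>) \<in> sep_feasible X f" and o: "sep_objective ystar (w, \<alpha>) \<le> c"
      using t by (auto simp: t_eq)
    have "norm w \<le> (\<Sum>i\<in>UNIV. \<bar>w $ i\<bar>)" by (rule norm_le_l1_cart)
    also have "\<dots> = 1" using S by (simp add: sep_feasible_def)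
    finally have w: "norm w \<le> 1" .
    have bd: "\<bar>z \<bullet> w\<bar> \<le> norm z" for z
      using Cauchy_Schwarz_ineq2[of z w] mult_left_mono[OF w, of "norm z"] by simp
    have "\<alpha> \<le> f x \<bullet> w" using S x by (auto simp: sep_feasible_def)
    moreover have "ystar \<bullet> w - \<alpha> \<le> c" using o by (simp add: sep_objective_def)
    ultimately have "\<alpha> \<in> {- norm ystar - c .. norm (f x)}"
      using bd[of ystar] bd[of "f x"] by auto
    then show "t \<in> cball 0 1 \<times> {- norm ystar - c .. norm (f x)}" using w by (simp add: t_eq)
  qed
  then show ?thesis
    by (rule bounded_subset[rotated]) (intro bounded_Times bounded_cball bounded_closed_interval)
qed

text \<open>Sublevel sets of the objective are compact, so the minimum is attained. The minimizers
  form a nonempty compact face; it has an extreme point, and an extreme point of a face is extreme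
  in the whole set.\<close>

lemma optimal_extreme_point_solution_exists:
  assumes X: "X \<noteq> {}" and ne: "sep_feasible X f \<noteq> {}"
  shows "\<exists>s. optimal_extreme_point_solution X f ystar s"
proof -
  let ?S = "sep_feasible X f" and ?o = "sep_objective ystar"
  have cont: "continuous_on A ?o" for A
    unfolding sep_objective_eq_inner by (intro continuous_intros)
  have compact: "compact {t \<in> ?S. ?o t \<le> c}" for c
  proof -
    have "{t \<in> ?S. ?o t \<le> c} = ?S \<inter> {t. ?o t \<le> c}" by blast
    then have "closed {t \<in> ?S. ?o t \<le> c}"
      by (simp add: closed_Int closed_sep_feasible closed_Collect_le cont)
    then show ?thesis using bounded_sep_sublevel[OF X] by (simp add: compact_eq_bounded_closed)
  qed
  obtain t0 where t0: "t0 \<in> ?S" using ne by blast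
  then have "{t \<in> ?S. ?o t \<le> ?o t0} \<noteq> {}" by blast
  \<comment> \<open>A minimum over the sublevel set of \<open>t0\<close> is global, because every
    other feasible point has a larger value than \<open>t0\<close>.\<close>
  from continuous_attains_inf[OF compact this cont]
  obtain s0 where s0: "s0 \<in> ?S" "?o s0 \<le> ?o t0"
    and min0: "\<And>t. t \<in> ?S \<Longrightarrow> ?o t \<le> ?o t0 \<Longrightarrow> ?o s0 \<le> ?o t"
    by blast
  have min: "?o s0 \<le> ?o t" if "t \<in> ?S" for t
    using min0[OF that] s0 by linarith
  define F where "F = ?S \<inter> {t. (ystar, - 1) \<bullet> t = ?o s0}"
  have face: "F face_of ?S" unfolding F_def
    using min by (intro face_of_Int_supporting_hyperplane_ge convex_sep_feasible)
      (simp add: sep_objective_eq_inner)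
  \<comment> \<open>At the minimal value the level set and the sublevel set coincide, which makes
    the face compact.\<close>
  have "F = {t \<in> ?S. ?o t \<le> ?o s0}"
    using min by (auto simp: F_def sep_objective_eq_inner intro!: antisym)
  then have "compact F" using compact by simp
  moreover have "convex F" using face by (rule face_of_imp_convex)
  moreover have "F \<noteq> {}" using s0 by (auto simp: F_def sep_objective_eq_inner)
  ultimately obtain s where s: "s extreme_point_of F"
    by (rule extreme_point_exists_convex)
  then have "s extreme_point_of ?S" "s \<in> F"
    using extreme_point_of_face[OF face] by auto
  then show ?thesis
    using min unfolding optimal_extreme_point_solution_def
    by (intro exI[of _ s]) (simp add: F_def sep_objective_eq_inner)
qed

section \<open>Extreme feasible points support facets\<close>

text \<open>Here \<open>g\<close> is the slack of a constraint and \<open>h\<close> its rate of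
  change under a perturbation. A positive slack tolerates all small steps, a zero slack does not
  change, and finitely many constraints share a common step size. The absolute value covers both
  directions.\<close>

lemma finite_slack:
  fixes g h :: "'b \<Rightarrow> real"
  assumes "finite A" "\<And>a. a \<in> A \<Longrightarrow> 0 \<le> g a" "\<And>a. a \<in> A \<Longrightarrow> g a = 0 \<Longrightarrow> h a = 0"
  obtains \<epsilon> where "0 < \<epsilon>" "\<And>a. a \<in> A \<Longrightarrow> \<epsilon> * \<bar>h a\<bar> \<le> g a"
proof -
  have "\<forall>\<^sub>F \<epsilon> in at_right 0. \<epsilon> * \<bar>h a\<bar> \<le> g a" if "a \<in> A" for a
  proof (cases "g a = 0")
    case True
    then show ?thesis using assms(3)[OF that] by simp
  next
    case False
    then have "0 < g a" using assms(2)[OF that] by simp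
    moreover have "((\<lambda>\<epsilon>. \<epsilon> * \<bar>h a\<bar>) \<longlongrightarrow> 0 * \<bar>h a\<bar>) (at_right 0)"
      by (intro tendsto_intros)
    ultimately have "\<forall>\<^sub>F \<epsilon> in at_right 0. \<epsilon> * \<bar>h a\<bar> < g a"
      by (intro order_tendstoD) auto
    then show ?thesis by eventually_elim simp
  qed
  then have "\<forall>\<^sub>F \<epsilon> in at_right 0. \<forall>a\<in>A. \<epsilon> * \<bar>h a\<bar> \<le> g a"
    using assms(1) by (simp add: eventually_ball_finite)
  then have "\<forall>\<^sub>F \<epsilon> in at_right 0. 0 < \<epsilon> \<and> (\<forall>a\<in>A. \<epsilon> * \<bar>h a\<bar> \<le> g a)"
    by (intro eventually_conj eventually_at_right_less)
  from eventually_happens'[OF _ this] show thesis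
    using that trivial_limit_at_right_real by auto
qed

text \<open>Around \<open>y + 1\<close>, where \<open>1\<close> is the all-ones vector, the open
  unit ball stays inside \<open>y\<close> plus the orthant, so the hull has nonempty
  interior.\<close>

lemma aff_dim_edgeworth_pareto_hull:
  fixes f :: "'a \<Rightarrow> real ^ 'p"
  assumes "edgeworth_pareto_hull X f \<noteq> {}"
  shows "aff_dim (edgeworth_pareto_hull X f) = int (CARD('p))"
proof -
  obtain y where y: "y \<in> edgeworth_pareto_hull X f" using assms by blast
  have "ball (y + 1) 1 \<subseteq> edgeworth_pareto_hull X f"
  proof
    fix z assume "z \<in> ball (y + 1) 1"
    then have "norm (y + 1 - z) < 1" by (simp add: dist_norm)
    then have "\<bar>(y + 1 - z) $ i\<bar> < 1" for i
      using component_le_norm_cart[of "y + 1 - z" i] by linarith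
    then have "z - y \<in> nonneg_orthant"
      by (simp add: nonneg_orthant_iff abs_less_iff algebra_simps) (meson less_eq_real_def)
    then show "z \<in> edgeworth_pareto_hull X f"
      using edgeworth_pareto_hull_add_orthant[OF y] by fastforce
  qed
  then have "interior (edgeworth_pareto_hull X f) \<noteq> {}"
    by (metis interior_maximal open_ball centre_in_ball zero_less_one subsetD empty_iff)
  then show ?thesis by (simp add: aff_dim_nonempty_interior)
qed

text \<open>The hyperplane bounds the dimension of the face from above. Extremality bounds it from
  below: a smaller face would leave room to move \<open>(w, \<alpha>)\<close> both ways along a line
  within the feasible set.\<close>

lemma extreme_point_imp_facet:
  fixes f :: "'a \<Rightarrow> real ^ 'p"
  assumes V: "finite V"
      "edgeworth_pareto_hull X f = {v + c | v c. v \<in> convex hull V \<and> c \<in> nonneg_orthant}"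
    and ext: "(w, \<alpha>) extreme_point_of sep_feasible X f"
    and supp: "supports w \<alpha> (edgeworth_pareto_hull X f)"
  shows "(edgeworth_pareto_hull X f \<inter> hyperplane w \<alpha>) facet_of edgeworth_pareto_hull X f"
proof -
  let ?P = "edgeworth_pareto_hull X f"
  define F where "F = ?P \<inter> hyperplane w \<alpha>"
  have feas_iff: "(u, \<beta>) \<in> sep_feasible X f \<longleftrightarrow>
      u \<in> nonneg_orthant \<and> (\<Sum>i\<in>UNIV. u $ i) = 1 \<and> (\<forall>v\<in>V. \<beta> \<le> u \<bullet> v)" for u \<beta>
    using polytope_plus_orthant_ge_iff[OF V(2)] by (auto simp: sep_feasible_iff)
  have feas: "(w, \<alpha>) \<in> sep_feasible X f"
    using ext by (simp add: extreme_point_of_def)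
  have "F \<noteq> {}" and w0: "w \<noteq> 0" and ge: "\<And>y. y \<in> ?P \<Longrightarrow> \<alpha> \<le> w \<bullet> y"
    using supp by (auto simp: supports_def F_def)
  then obtain y0 where y0: "y0 \<in> F" by blast
  have VP: "v \<in> ?P" if "v \<in> V" for v
    using that polytope_plus_orthant_superset[OF V(2)] by blast
  have "convex ?P"
    unfolding V(2) by (rule convex_polytope_plus_orthant)
  then have face: "F face_of ?P"
    using face_of_Int_supporting_hyperplane_ge[of ?P \<alpha> w] ge by (simp add: F_def hyperplane_def)
  have "aff_dim F \<le> int CARD('p) - 1"
  proof -
    have "aff_dim F \<le> aff_dim {y. w \<bullet> y = \<alpha>}"
      by (rule aff_dim_subset) (auto simp: F_def hyperplane_def)
    then show ?thesis using w0 by simp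
  qed
  moreover have "\<not> aff_dim F < int CARD('p) - 1"
  proof
    assume low: "aff_dim F < int CARD('p) - 1"
    define D where "D = (\<lambda>y. - y0 + y) ` F"
    have "aff_dim F = int (dim D)"
      unfolding D_def using y0 by (intro aff_dim_eq_dim hull_inc)
    \<comment> \<open>The all-ones vector raises the dimension by at most one, so an orthogonal
      \<open>d\<close> still exists; orthogonality to it preserves the normalization of the
      weights.\<close>
    then have "dim (insert 1 D) < DIM(real ^ 'p)"
      using low by (simp add: dim_insert)
    from orthogonal_to_subspace_exists[OF this]
    obtain d :: "real ^ 'p" where d: "d \<noteq> 0"
      and orth: "\<And>y. y \<in> span (insert 1 D) \<Longrightarrow> orthogonal d y"
      by blast
    define \<delta> where "\<delta> = d \<bullet> y0"
    have dF: "d \<bullet> y = \<delta>" if "y \<in> F" for y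
    proof -
      have "- y0 + y \<in> span (insert 1 D)"
        using that by (auto simp: D_def intro: span_base)
      from orth[OF this] show ?thesis
        by (simp add: orthogonal_def inner_diff_right \<delta>_def)
    qed
    have "orthogonal d 1" by (intro orth span_base) simp
    then have d1: "(\<Sum>i\<in>UNIV. d $ i) = 0" by (simp add: orthogonal_def inner_vec_def)
    have di: "d $ i = 0" if "w $ i = 0" for i
    proof -
      \<comment> \<open>When \<open>w $ i = 0\<close>, moving along the \<open>i\<close>-th axis
        stays in the hull and on the hyperplane; constancy of \<open>d\<close> on \<open>F\<close>
        then forces \<open>d $ i = 0\<close>.\<close>
      have "y0 + axis i 1 \<in> F"
        using y0 that edgeworth_pareto_hull_add_orthant[of y0 X f "axis i 1"] axis_nonneg_orthant[of i]
        by (simp add: F_def hyperplane_def inner_add_right inner_axis)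
      from dF[OF this] show ?thesis by (simp add: \<delta>_def inner_add_right inner_axis)
    qed
    have dV: "d \<bullet> v - \<delta> = 0" if "v \<in> V" "w \<bullet> v - \<alpha> = 0" for v
      using dF[of v] VP[of v] that by (simp add: F_def hyperplane_def)
    \<comment> \<open>\<open>\<epsilon>1\<close> protects the sign constraints on the weights,
      \<open>\<epsilon>2\<close> the constraints from the generators.\<close>
    obtain \<epsilon>1 where \<epsilon>1: "0 < \<epsilon>1" "\<And>i. \<epsilon>1 * \<bar>d $ i\<bar> \<le> w $ i"
      using finite_slack[of UNIV "\<lambda>i. w $ i" "\<lambda>i. d $ i"] di feas
      by (auto simp: sep_feasible_def)
    obtain \<epsilon>2 where \<epsilon>2: "0 < \<epsilon>2" "\<And>v. v \<in> V \<Longrightarrow> \<epsilon>2 * \<bar>d \<bullet> v - \<delta>\<bar> \<le> w \<bullet> v - \<alpha>"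
      using finite_slack[of V "\<lambda>v. w \<bullet> v - \<alpha>" "\<lambda>v. d \<bullet> v - \<delta>"] V(1) dV feas
      by (auto simp: feas_iff)
    define \<epsilon> where "\<epsilon> = min \<epsilon>1 \<epsilon>2"
    have \<epsilon>: "0 < \<epsilon>" using \<epsilon>1 \<epsilon>2 by (simp add: \<epsilon>_def)
    have move: "(w + \<tau> *\<^sub>R d, \<alpha> + \<tau> * \<delta>) \<in> sep_feasible X f" if \<tau>: "\<bar>\<tau>\<bar> = \<epsilon>" for \<tau>
    proof -
      have "0 \<le> w $ i + \<tau> * d $ i" for i
      proof -
        have "\<bar>\<tau> * d $ i\<bar> \<le> \<epsilon>1 * \<bar>d $ i\<bar>"
          unfolding abs_mult \<tau> by (intro mult_right_mono) (auto simp: \<epsilon>_def)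
        then show ?thesis using \<epsilon>1(2)[of i] by linarith
      qed
      then have "w + \<tau> *\<^sub>R d \<in> nonneg_orthant"
        by (simp add: nonneg_orthant_iff)
      moreover have "(\<Sum>i\<in>UNIV. (w + \<tau> *\<^sub>R d) $ i) = 1"
        using feas d1 by (simp add: feas_iff sum.distrib flip: sum_distrib_left)
      moreover have "\<alpha> + \<tau> * \<delta> \<le> (w + \<tau> *\<^sub>R d) \<bullet> v" if v: "v \<in> V" for v
      proof -
        have "\<bar>\<tau> * (d \<bullet> v - \<delta>)\<bar> \<le> \<epsilon>2 * \<bar>d \<bullet> v - \<delta>\<bar>"
          unfolding abs_mult \<tau> by (intro mult_right_mono) (auto simp: \<epsilon>_def)
        then have "\<bar>\<tau> * (d \<bullet> v - \<delta>)\<bar> \<le> w \<bullet> v - \<alpha>"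
          using \<epsilon>2(2)[OF v] by linarith
        then show ?thesis by (simp add: inner_add_left algebra_simps abs_le_iff)
      qed
      ultimately show ?thesis by (simp add: feas_iff)
    qed
    \<comment> \<open>Writing the second point with \<open>- \<epsilon>\<close> makes both points
      instances of \<open>move\<close>.\<close>
    let ?a = "(w + \<epsilon> *\<^sub>R d, \<alpha> + \<epsilon> * \<delta>)" and ?b = "(w + (- \<epsilon>) *\<^sub>R d, \<alpha> + (- \<epsilon>) * \<delta>)"
    have "?a \<in> sep_feasible X f" "?b \<in> sep_feasible X f"
      using \<epsilon> by (intro move; simp)+
    moreover have "?a \<noteq> ?b"
      using \<epsilon> d by (simp add: eq_neg_iff_add_eq_0 flip: scaleR_add_left)
    moreover have "midpoint ?a ?b = (w, \<alpha>)"
      by (simp add: midpoint_def scaleR_add_right flip: scaleR_2 mult_2)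
    ultimately show False
      using ext midpoint_in_open_segment[of ?a ?b] by (auto simp: extreme_point_of_def)
  qed
  moreover have "aff_dim ?P = int CARD('p)"
    using y0 by (intro aff_dim_edgeworth_pareto_hull) (auto simp: F_def)
  ultimately show ?thesis
    using face \<open>F \<noteq> {}\<close> by (simp add: facet_of_def F_def)
qed

section \<open>Optimality gives support and separation\<close>

text \<open>For fixed \<open>w\<close> the objective falls as \<open>\<alpha>\<close> grows, and
  \<open>\<alpha>\<close> may grow up to the least value of \<open>w\<close> on the generators. An
  optimal \<open>\<alpha>\<close> equals that value, so the hyperplane meets the hull at a
  generator, wherever \<open>ystar\<close> lies.\<close>

lemma optimal_sep_solution_supports:
  fixes f :: "'a \<Rightarrow> real ^ 'p"
  assumes V: "finite V" "V \<noteq> {}"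
      "edgeworth_pareto_hull X f = {v + c | v c. v \<in> convex hull V \<and> c \<in> nonneg_orthant}"
    and opt: "optimal_extreme_point_solution X f ystar (w, \<alpha>)"
  shows "supports w \<alpha> (edgeworth_pareto_hull X f)"
proof -
  let ?P = "edgeworth_pareto_hull X f"
  have feas: "(w, \<alpha>) \<in> sep_feasible X f"
    and min: "\<And>t. t \<in> sep_feasible X f \<Longrightarrow> sep_objective ystar (w, \<alpha>) \<le> sep_objective ystar t"
    using opt by (auto simp: optimal_extreme_point_solution_def extreme_point_of_def)
  have w: "w \<in> nonneg_orthant" "(\<Sum>i\<in>UNIV. w $ i) = 1" and ge: "\<And>y. y \<in> ?P \<Longrightarrow> \<alpha> \<le> w \<bullet> y"
    using feas by (auto simp: sep_feasible_iff)
  define \<beta> where "\<beta> = Min ((\<lambda>v. w \<bullet> v) ` V)"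
  have "\<beta> \<in> (\<lambda>v. w \<bullet> v) ` V"
    unfolding \<beta>_def using V by (intro Min_in) auto
  then obtain v where v: "v \<in> V" "w \<bullet> v = \<beta>" by auto
  have "\<forall>v\<in>V. \<beta> \<le> w \<bullet> v"
    using V(1) by (simp add: \<beta>_def)
  then have "(w, \<beta>) \<in> sep_feasible X f"
    using polytope_plus_orthant_ge_iff[OF V(3) w(1)] w by (simp add: sep_feasible_iff)
  from min[OF this] have "\<beta> \<le> \<alpha>" by (simp add: sep_objective_def)
  have vP: "v \<in> ?P" using v(1) polytope_plus_orthant_superset[OF V(3)] by blast
  then have "w \<bullet> v = \<alpha>" using ge[OF vP] v \<open>\<beta> \<le> \<alpha>\<close> by simp
  moreover have "w \<noteq> 0" using w(2) by auto
  ultimately show ?thesis using vP ge by (auto simp: supports_def hyperplane_def)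
qed

text \<open>The hull is closed and convex, so some \<open>(a, b)\<close> separates
  \<open>ystar\<close> strictly. The hull recedes along the orthant, which makes \<open>a\<close>
  nonnegative, and dividing by its coordinate sum yields a feasible point.\<close>

lemma outside_imp_negative_sep_objective:
  fixes f :: "'a \<Rightarrow> real ^ 'p"
  assumes V: "finite V" "V \<noteq> {}"
      "edgeworth_pareto_hull X f = {v + c | v c. v \<in> convex hull V \<and> c \<in> nonneg_orthant}"
    and out: "ystar \<notin> edgeworth_pareto_hull X f"
  obtains t where "t \<in> sep_feasible X f" "sep_objective ystar t < 0"
proof -
  let ?P = "edgeworth_pareto_hull X f"
  have "closed ?P" unfolding V(3) by (rule closed_polytope_plus_orthant[OF V(1)])
  moreover have "convex ?P" unfolding V(3) by (rule convex_polytope_plus_orthant)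
  ultimately obtain a b where ab: "a \<bullet> ystar < b" "\<And>y. y \<in> ?P \<Longrightarrow> b < a \<bullet> y"
    using separating_hyperplane_closed_point[of ?P ystar] out by blast
  obtain y where y: "y \<in> ?P"
    using V(2) polytope_plus_orthant_superset[OF V(3)] by blast
  have a: "a \<in> nonneg_orthant"
    using ab(2) edgeworth_pareto_hull_add_orthant[OF y]
    by (intro nonneg_orthant_if_bounded_below[of b a y]) (simp add: less_imp_le)
  \<comment> \<open>A zero normal would give both \<open>0 < b\<close> and
    \<open>b < 0\<close>.\<close>
  have "a \<noteq> 0" using ab(1) ab(2)[OF y] by auto
  define \<sigma> where "\<sigma> = (\<Sum>i\<in>UNIV. a $ i)"
  have \<sigma>: "0 < \<sigma>"
  proof -
    have "\<sigma> \<noteq> 0"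
      using \<open>a \<noteq> 0\<close> a by (auto simp: \<sigma>_def sum_nonneg_eq_0_iff nonneg_orthant_iff vec_eq_iff)
    moreover have "0 \<le> \<sigma>" using a by (simp add: \<sigma>_def nonneg_orthant_iff sum_nonneg)
    ultimately show ?thesis by simp
  qed
  show thesis
  proof
    show "((1 / \<sigma>) *\<^sub>R a, b / \<sigma>) \<in> sep_feasible X f"
      using a \<sigma> ab(2)
      by (auto simp: sep_feasible_iff nonneg_orthant_iff divide_right_mono less_imp_le
          simp flip: sum_divide_distrib \<sigma>_def)
    show "sep_objective ystar ((1 / \<sigma>) *\<^sub>R a, b / \<sigma>) < 0"
      using ab(1) \<sigma> by (simp add: sep_objective_def inner_commute divide_strict_right_mono)
  qed
qed

section \<open>Solvability of the separation problem and correctness of the oracle\<close>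

theorem theorem8:
  fixes X :: "'a set" and f :: "'a \<Rightarrow> real ^ 'p"
  assumes "\<And>w :: real ^ 'p. (\<forall>i. w $ i \<in> \<rat> \<and> w $ i \<ge> 0) \<Longrightarrow> weighted_sum_finite X f w"
    and "finitely_generated (edgeworth_pareto_hull X f)"
  shows "(\<forall>ystar. \<exists>s. optimal_extreme_point_solution X f ystar s) \<and>
    (\<forall>sol. (\<forall>ystar. optimal_extreme_point_solution X f ystar (sol ystar)) \<longrightarrow>
      point_separating_oracle (edgeworth_pareto_hull X f) (sep_procedure sol) \<and>
      (\<forall>ystar H. sep_procedure sol ystar = (Outside, H) \<longrightarrow>
        facet_supporting H (edgeworth_pareto_hull X f)))"
proof -
  let ?P = "edgeworth_pareto_hull X f"
  \<comment> \<open>Unit vectors are rational and nonnegative, so finiteness applies to each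
    coordinate of \<open>f\<close>.\<close>
  have fin: "weighted_sum_finite X f (axis i 1)" for i
    by (rule assms(1)) (simp add: axis_def)
  obtain V where V: "finite V" "V \<noteq> {}"
    "?P = {v + c | v c. v \<in> convex hull V \<and> c \<in> nonneg_orthant}"
    using edgeworth_pareto_hull_eq_polytope_plus_orthant[OF fin assms(2)] by blast
  have X: "X \<noteq> {}" using weighted_sum_finite_imp_nonempty[OF fin] .
  have "sep_feasible X f \<noteq> {}"
  proof -
    \<comment> \<open>Index types are nonempty, so some coordinate exists; its unit vector lies in
      the simplex, and a lower bound on that coordinate serves as \<open>\<alpha>\<close>.\<close>
    obtain i :: 'p where True by blast
    obtain m where "\<And>x. x \<in> X \<Longrightarrow> m \<le> axis i 1 \<bullet> f x"
      using weighted_sum_finite_imp_bounded_below[OF fin] by blast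
    then have "(axis i 1, m) \<in> sep_feasible X f"
      by (auto simp: sep_feasible_def inner_commute axis_def)
    then show ?thesis by blast
  qed
  then have "\<forall>ystar. \<exists>s. optimal_extreme_point_solution X f ystar s"
    using optimal_extreme_point_solution_exists[OF X] by blast
  moreover have "point_separating_oracle ?P (sep_procedure sol) \<and>
      (\<forall>ystar H. sep_procedure sol ystar = (Outside, H) \<longrightarrow> facet_supporting H ?P)"
    if sol: "\<forall>ystar. optimal_extreme_point_solution X f ystar (sol ystar)" for sol
  proof -
    have supp: "supports (fst (sol y)) (snd (sol y)) ?P" for y
      using optimal_sep_solution_supports[OF V] sol by (metis prod.collapse)
    have proc: "sep_procedure sol y =
        (if sep_objective y (sol y) < 0
         then (Outside, hyperplane (fst (sol y)) (snd (sol y))) else (Inside, {}))" for y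
      by (simp add: sep_procedure_def sep_objective_def case_prod_beta)
    \<comment> \<open>The supporting inequality at \<open>y\<close> itself says that the objective
      value is nonnegative.\<close>
    have "sep_procedure sol y = (Inside, {})" if "y \<in> ?P" for y
      using supp[of y] that
      by (auto simp: proc supports_def sep_objective_def case_prod_beta inner_commute)
    \<comment> \<open>Some feasible point has a negative value, and the optimal value is no
      larger.\<close>
    moreover have "sep_objective y (sol y) < 0" if y: "y \<notin> ?P" for y
    proof -
      obtain t where "t \<in> sep_feasible X f" "sep_objective y t < 0"
        using outside_imp_negative_sep_objective[OF V y] .
      then show ?thesis
        using sol unfolding optimal_extreme_point_solution_def by (meson le_less_trans)
    qed
    moreover have "fst (sol y) \<bullet> y < snd (sol y) \<and> (\<forall>z\<in>?P. snd (sol y) \<le> fst (sol y) \<bullet> z)"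
      if "sep_objective y (sol y) < 0" for y
      using that supp[of y]
      by (simp add: supports_def sep_objective_def case_prod_beta inner_commute)
    ultimately have "point_separating_oracle ?P (sep_procedure sol)"
      using supp unfolding point_separating_oracle_def proc by (metis (no_types, lifting))
    moreover have "facet_supporting H ?P" if "sep_procedure sol y = (Outside, H)" for y H
    proof -
      have H: "H = hyperplane (fst (sol y)) (snd (sol y))"
        using that by (auto simp: proc split: if_splits)
      have "(fst (sol y), snd (sol y)) extreme_point_of sep_feasible X f"
        using sol by (simp add: optimal_extreme_point_solution_def)
      from extreme_point_imp_facet[OF V(1,3) this supp] show ?thesis
        using supp H by (auto simp: facet_supporting_def)
    qed
    ultimately show ?thesis by blast
  qed
  ultimately show ?thesis by blast
qed

end
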